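(* Let $G=(V,w,m)$ be a graph, let $x_0\in V$ be a root vertex and let $\kappa(r)$ be the sphere curvatures of $G$ with respect to $x_0$. Let $\widetilde G=(\mathbb N_0,\widetilde w,\widetilde m)$ be the birth-death chain associated to $G$ and $x_0$, with root vertex $\widetilde x_0=0$ and sphere curvatures $\widetilde\kappa(r)=\widetilde\kappa(r,r-1)$. Then, for $R\ge1$, $$\sum_{r=1}^R\widetilde\kappa(r)\ge\sum_{r=1}^R\kappa(r).$$
   Context: A graph is a triple $G=(V,w,m)$ with $V$ a countable set, $w:V\times V\to[0,\infty)$ symmetric and zero on the diagonal, and $m:V\to(0,\infty)$. Write $x\sim y$ if $w(x,y)>0$. All graphs are locally finite (for each $x$ only finitely many $y$ satisfy $x\sim y$) and connected; $d(x,y)=\inf\{n: x=z_0\sim\cdots\sim z_n=y\}$ is the combinatorial distance, which is finite by connectedness. A birth-death chain is a graph $(\mathbb N_0,w,m)$ with $w(k,n)=0$ whenever $|k-n|\neq1$. $\mathrm{Deg}(x)=\frac1{m(x)}\sum_{y}w(x,y)$. $Lip(1)$ is the set of $f:V\to\mathbb R$ with $|f(x)-f(y)|\le d(x,y)$ for all $x,y$. Curvature: for $x\in V$ and $\varepsilon>0$ let $m_x^\varepsilon(x)=1-\varepsilon\,\mathrm{Deg}(x)$ and $m_x^\varepsilon(y)=\varepsilon w(x,y)/m(x)$ for $y\neq x$; this is a finitely supported probability measure for $\varepsilon$ small. For probability measures $\mu,\nu$ on $V$, $W(\mu,\nu)=\sup_{f}\sum_{x}f(x)(\mu(x)-\nu(x))$,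 the supremum over bounded $f\in Lip(1)$. For $x\neq y$ let $\kappa_\varepsilon(x,y)=1-\frac{W(m_x^\varepsilon,m_y^\varepsilon)}{d(x,y)}$ and $\kappa(x,y)=\lim_{\varepsilon\to0^+}\frac1\varepsilon\kappa_\varepsilon(x,y)$ (this limit exists); $\widetilde\kappa(\cdot,\cdot)$ is the same quantity for $\widetilde G$. Sphere curvatures with respect to $x_0$: with $S_r=\{y: d(x_0,y)=r\}$, for $r\ge1$, $\kappa(r)=\min_{y\in S_r}\max_{x\in S_{r-1},\,x\sim y}\kappa(x,y)$. Associated birth-death chain: $\widetilde G=(\mathbb N_0,\widetilde w,\widetilde m)$ is given by $\widetilde m(r):=m(S_r)=\sum_{x\in S_r}m(x)$ and $\widetilde w(r,r+1)=\widetilde w(r+1,r):=w(S_r,S_{r+1})=\sum_{x\in S_r,\,y\in S_{r+1}}w(x,y)$ for $r\ge0$, and $\widetilde w=0$ otherwise. *)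

theory Defs
  imports "HOL-Analysis.Analysis"
begin

record 'a wgraph =
  verts :: "'a set"
  weight :: "'a \<Rightarrow> 'a \<Rightarrow> real"
  mass :: "'a \<Rightarrow> real"

definition adj :: "'a wgraph \<Rightarrow> 'a \<Rightarrow> 'a \<Rightarrow> bool" where
  "adj G x y \<longleftrightarrow> x \<in> verts G \<and> y \<in> verts G \<and> weight G x y > 0"

locale weighted_graph =
  fixes G :: "'a wgraph"
  assumes countable_verts: "countable (verts G)"
    and weight_nonneg: "\<And>x y. x \<in> verts G \<Longrightarrow> y \<in> verts G \<Longrightarrow> weight G x y \<ge> 0"
    and weight_sym: "\<And>x y. x \<in> verts G \<Longrightarrow> y \<in> verts G \<Longrightarrow> weight G x y = weight G y x"
    and weight_diag: "\<And>x. x \<in> verts G \<Longrightarrow> weight G x x = 0"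
    and mass_pos: "\<And>x. x \<in> verts G \<Longrightarrow> mass G x > 0"
    and locally_finite: "\<And>x. x \<in> verts G \<Longrightarrow> finite {y. adj G x y}"
    and connected: "\<And>x y. x \<in> verts G \<Longrightarrow> y \<in> verts G \<Longrightarrow> \<exists>n. (adj G ^^ n) x y"

text \<open>Combinatorial distance. The set is nonempty for vertices of a connected graph, so the
  infimum in the natural numbers is the intended one.\<close>

definition gdist :: "'a wgraph \<Rightarrow> 'a \<Rightarrow> 'a \<Rightarrow> nat" where
  "gdist G x y = Inf {n. (adj G ^^ n) x y}"

definition Lip1 :: "'a wgraph \<Rightarrow> ('a \<Rightarrow> real) set" where
  "Lip1 G = {f. \<forall>x\<in>verts G. \<forall>y\<in>verts G. \<bar>f x - f y\<bar> \<le> real (gdist G x y)}"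

text \<open>Only neighbours contribute to the sum of all weights at a vertex.\<close>

definition Deg :: "'a wgraph \<Rightarrow> 'a \<Rightarrow> real" where
  "Deg G x = (\<Sum>y | adj G x y. weight G x y) / mass G x"

definition walk_measure :: "'a wgraph \<Rightarrow> real \<Rightarrow> 'a \<Rightarrow> 'a \<Rightarrow> real" where
  "walk_measure G \<epsilon> x y =
     (if y = x then 1 - \<epsilon> * Deg G x else \<epsilon> * weight G x y / mass G x)"

definition wasserstein :: "'a wgraph \<Rightarrow> ('a \<Rightarrow> real) \<Rightarrow> ('a \<Rightarrow> real) \<Rightarrow> real" where
  "wasserstein G \<mu> \<nu> =
     (SUP f \<in> {f \<in> Lip1 G. bounded (f ` verts G)}.
        \<Sum>\<^sub>\<infinity>x\<in>verts G. f x * (\<mu> x - \<nu> x))"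

definition curvature_eps :: "'a wgraph \<Rightarrow> real \<Rightarrow> 'a \<Rightarrow> 'a \<Rightarrow> real" where
  "curvature_eps G \<epsilon> x y =
     1 - wasserstein G (walk_measure G \<epsilon> x) (walk_measure G \<epsilon> y) / real (gdist G x y)"

definition curvature :: "'a wgraph \<Rightarrow> 'a \<Rightarrow> 'a \<Rightarrow> real" where
  "curvature G x y = Lim (at_right 0) (\<lambda>\<epsilon>. curvature_eps G \<epsilon> x y / \<epsilon>)"

definition sphere_at :: "'a wgraph \<Rightarrow> 'a \<Rightarrow> nat \<Rightarrow> 'a set" where
  "sphere_at G x0 r = {y \<in> verts G. gdist G x0 y = r}"

definition sphere_curvature :: "'a wgraph \<Rightarrow> 'a \<Rightarrow> nat \<Rightarrow> real" where
  "sphere_curvature G x0 r =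
     (MIN y \<in> sphere_at G x0 r.
        MAX x \<in> {x \<in> sphere_at G x0 (r - 1). adj G x y}. curvature G x y)"

text \<open>If \<open>G\<close> is infinite, all spheres are nonempty and the vertex set below is all of
  \<open>\<nat>\<close> (see \<open>verts_associated_chain\<close>). If \<open>G\<close> is finite, the construction gives mass zero to
  radii with empty sphere; such radii are not vertices.\<close>

definition associated_chain :: "'a wgraph \<Rightarrow> 'a \<Rightarrow> nat wgraph" where
  "associated_chain G x0 =
     \<lparr> verts = {r. sphere_at G x0 r \<noteq> {}},
       weight = (\<lambda>k n. if n = k + 1 \<or> k = n + 1
                  then \<Sum>x\<in>sphere_at G x0 (min k n). \<Sum>y\<in>sphere_at G x0 (max k n). weight G x y
                  else 0),
       mass = (\<lambda>r. \<Sum>x\<in>sphere_at G x0 r. mass G x) \<rparr>"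

context weighted_graph
begin

lemma adj_sym: "adj G x y \<Longrightarrow> adj G y x"
  using weight_sym by (auto simp: adj_def)

lemma gdist_le: "(adj G ^^ n) x y \<Longrightarrow> gdist G x y \<le> n"
  by (auto simp: gdist_def intro: wellorder_Inf_le1)

lemma gdist_walk: "x \<in> verts G \<Longrightarrow> y \<in> verts G \<Longrightarrow> (adj G ^^ gdist G x y) x y"
  using connected[of x y] Inf_nat_def1[of "{n. (adj G ^^ n) x y}"] by (auto simp: gdist_def)

lemma sphere_at_0: "x0 \<in> verts G \<Longrightarrow> sphere_at G x0 0 = {x0}"
  using gdist_walk[of x0] gdist_le[of 0 x0 x0] by (force simp: sphere_at_def)

lemma sphere_at_SucE:
  assumes "x0 \<in> verts G" "y \<in> sphere_at G x0 (Suc n)"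
  obtains x where "x \<in> sphere_at G x0 n" "adj G x y"
proof -
  have y: "y \<in> verts G" "gdist G x0 y = Suc n"
    using assms by (auto simp: sphere_at_def)
  then have "(adj G ^^ Suc n) x0 y"
    using gdist_walk[of x0 y] assms by simp
  then obtain x where x: "(adj G ^^ n) x0 x" "adj G x y"
    by (auto elim: relpowp_Suc_E)
  then have xV: "x \<in> verts G" by (simp add: adj_def)
  have "(adj G ^^ Suc (gdist G x0 x)) x0 y"
    using gdist_walk[OF assms(1) xV] x(2) by auto
  then have "Suc n \<le> Suc (gdist G x0 x)"
    using gdist_le y(2) by metis
  moreover have "gdist G x0 x \<le> n"
    using gdist_le x(1) by blast
  ultimately show thesis
    using that[of x] x(2) xV by (auto simp: sphere_at_def)
qed

lemma finite_sphere_at: "x0 \<in> verts G \<Longrightarrow> finite (sphere_at G x0 n)"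
proof (induction n)
  case 0
  then show ?case by (simp add: sphere_at_0)
next
  case (Suc n)
  have "sphere_at G x0 (Suc n) \<subseteq> (\<Union>x\<in>sphere_at G x0 n. {y. adj G x y})"
    using sphere_at_SucE[OF Suc.prems] by blast
  moreover have "finite (\<Union>x\<in>sphere_at G x0 n. {y. adj G x y})"
    using Suc locally_finite by (auto simp: sphere_at_def)
  ultimately show ?case by (rule finite_subset)
qed

lemma sphere_at_nonempty_mono:
  assumes "x0 \<in> verts G" "sphere_at G x0 n \<noteq> {}" "k \<le> n"
  shows "sphere_at G x0 k \<noteq> {}"
  using assms(3,2)
proof (induction rule: inc_induct)
  case (step i)
  then show ?case using sphere_at_SucE[OF assms(1)] by blast
qed auto

lemma verts_associated_chain:
  assumes "x0 \<in> verts G" "infinite (verts G)"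
  shows "verts (associated_chain G x0) = UNIV"
proof -
  have "sphere_at G x0 r \<noteq> {}" for r
  proof
    assume e: "sphere_at G x0 r = {}"
    have "verts G \<subseteq> (\<Union>n<r. sphere_at G x0 n)"
    proof
      fix y assume y: "y \<in> verts G"
      then have "\<not> r \<le> gdist G x0 y"
        using sphere_at_nonempty_mono[OF assms(1), of "gdist G x0 y" r] e
        by (auto simp: sphere_at_def)
      then show "y \<in> (\<Union>n<r. sphere_at G x0 n)"
        using y by (auto simp: sphere_at_def)
    qed
    moreover have "finite (\<Union>n<r. sphere_at G x0 n)"
      using finite_sphere_at[OF assms(1)] by blast
    ultimately show False
      using assms(2) finite_subset by blast
  qed
  then show ?thesis by (simp add: associated_chain_def)
qed

lemma weighted_graph_associated_chain:
  assumes x0: "x0 \<in> verts G"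
  shows "weighted_graph (associated_chain G x0)"
proof -
  let ?C = "associated_chain G x0"
  have V: "k \<in> verts ?C \<longleftrightarrow> sphere_at G x0 k \<noteq> {}" for k
    by (simp add: associated_chain_def)
  have nonneg: "weight ?C k n \<ge> 0" for k n
    by (auto simp: associated_chain_def sphere_at_def intro!: sum_nonneg weight_nonneg)
  have sym: "weight ?C k n = weight ?C n k" for k n
    unfolding associated_chain_def by (auto simp: min.commute[of k] max.commute[of k])
  have step: "adj ?C k (Suc k)" if S: "sphere_at G x0 (Suc k) \<noteq> {}" for k
  proof -
    obtain x y where y: "y \<in> sphere_at G x0 (Suc k)" and x: "x \<in> sphere_at G x0 k" "adj G x y"
      using S sphere_at_SucE[OF x0] by blast
    have "0 < (\<Sum>z\<in>sphere_at G x0 (Suc k). weight G x z)"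
      using y x finite_sphere_at[OF x0]
      by (intro sum_pos2[where i = y]) (auto simp: adj_def sphere_at_def intro: weight_nonneg)
    moreover have "0 \<le> (\<Sum>z\<in>sphere_at G x0 (Suc k). weight G x' z)"
      if "x' \<in> sphere_at G x0 k" for x'
      using that by (intro sum_nonneg weight_nonneg) (auto simp: sphere_at_def)
    ultimately have "0 < (\<Sum>x\<in>sphere_at G x0 k. \<Sum>z\<in>sphere_at G x0 (Suc k). weight G x z)"
      by (rule sum_pos2[OF finite_sphere_at[OF x0] x(1)])
    then show ?thesis
      using S x(1) unfolding adj_def V by (auto simp: associated_chain_def)
  qed
  have up: "(adj ?C ^^ k) 0 k" if "k \<in> verts ?C" for k
    using that
  proof (induction k)
    case (Suc k)
    then have S: "sphere_at G x0 (Suc k) \<noteq> {}" by (simp add: V)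
    then have "k \<in> verts ?C"
      using sphere_at_nonempty_mono[OF x0 S, of k] by (simp add: V)
    then show ?case using Suc.IH step[OF S] by auto
  qed simp
  have csym: "symp (adj ?C)"
    by (rule sympI) (metis adj_def sym)
  show ?thesis
  proof unfold_locales
    show "countable (verts ?C)" by simp
    show "weight ?C k k = 0" for k by (simp add: associated_chain_def)
    show "mass ?C k > 0" if "k \<in> verts ?C" for k
    proof -
      have "0 < (\<Sum>x\<in>sphere_at G x0 k. mass G x)"
        using that finite_sphere_at[OF x0] by (intro sum_pos mass_pos) (auto simp: V sphere_at_def)
      then show ?thesis by (simp add: associated_chain_def)
    qed
    show "finite {n. adj ?C k n}" for k
      by (rule finite_subset[of _ "{..Suc k}"]) (auto simp: adj_def associated_chain_def split: if_splits)
    show "\<exists>i. (adj ?C ^^ i) k n" if "k \<in> verts ?C" "n \<in> verts ?C" for k n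
    proof -
      have "(adj ?C)\<^sup>*\<^sup>* 0 k" "(adj ?C)\<^sup>*\<^sup>* 0 n"
        using up that by (blast intro: relpowp_imp_rtranclp)+
      then have "(adj ?C)\<^sup>*\<^sup>* k n"
        using csym by (meson symp_rtranclp sympD rtranclp_trans)
      then show ?thesis by (rule rtranclp_imp_relpowp)
    qed
  qed (rule nonneg sym)+
qed

end

end

theory Submission
  imports Defs
begin

text \<open>For a 1-Lipschitz \<open>f\<close> the pairing of \<open>f\<close> with \<open>m\<^sub>x\<^sup>\<epsilon> - m\<^sub>y\<^sup>\<epsilon>\<close> is
  \<open>f x - f y + \<epsilon> (\<Delta>f x - \<Delta>f y)\<close>. Hence, for \<open>x \<sim> y\<close>, the quotient \<open>\<kappa>\<^sub>\<epsilon>(x,y) / \<epsilon>\<close> is an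
  infimum of functions antitone in \<open>\<epsilon>\<close>, so its limit at \<open>0\<close> exists, and
  \<open>\<kappa>(x,y) \<le> \<Delta>f y - \<Delta>f x\<close> whenever \<open>f x - f y = 1\<close>. Applied to \<open>f = - d(x\<^sub>0, \<cdot>)\<close> along a path
  to the root this gives the Laplacian comparison
  \<open>\<Delta>d(x\<^sub>0, \<cdot>) \<le> Deg x\<^sub>0 - \<kappa>(1) - \<dots> - \<kappa>(R)\<close> on \<open>S\<^sub>R\<close>. On the associated chain the
  identity function is an optimal potential for all small \<open>\<epsilon>\<close>, so its sphere curvatures
  telescope to the same expression, in which \<open>\<Delta>d(x\<^sub>0, \<cdot>)\<close> is replaced by its average over
  \<open>S\<^sub>R\<close>.\<close>

section \<open>The graph Laplacian and its linearity\<close>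

definition laplacian :: "'a wgraph \<Rightarrow> ('a \<Rightarrow> real) \<Rightarrow> 'a \<Rightarrow> real" where
  "laplacian G f x = (\<Sum>y | adj G x y. weight G x y * (f y - f x)) / mass G x"

lemma laplacian_cong:
  assumes "f x = g x" "\<And>y. adj G x y \<Longrightarrow> f y = g y"
  shows "laplacian G f x = laplacian G g x"
  using assms by (simp add: laplacian_def)

lemma laplacian_uminus: "laplacian G (\<lambda>z. - f z) x = - laplacian G f x"
proof -
  have "weight G x y * (- f y - - f x) = - (weight G x y * (f y - f x))" for y
    by (simp add: algebra_simps)
  then show ?thesis by (simp only: laplacian_def sum_negf minus_divide_left)
qed

lemma laplacian_diff:
  "laplacian G (\<lambda>z. f z - g z) x = laplacian G f x - laplacian G g x"
proof -
  have "weight G x y * (f y - g y - (f x - g x))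
      = weight G x y * (f y - f x) - weight G x y * (g y - g x)" for y
    by (simp add: algebra_simps)
  then show ?thesis by (simp only: laplacian_def sum_subtractf diff_divide_distrib)
qed

context weighted_graph
begin

section \<open>Combinatorial distance and 1-Lipschitz functions\<close>

lemma relpowp_adj_sym: "(adj G ^^ n) x y \<Longrightarrow> (adj G ^^ n) y x"
proof (induction n arbitrary: y)
  case (Suc n)
  then obtain z where "(adj G ^^ n) x z" "adj G z y" by auto
  then show ?case using Suc.IH adj_sym by (meson relpowp_Suc_I2)
qed auto

lemma gdist_sym: "gdist G x y = gdist G y x"
  unfolding gdist_def using relpowp_adj_sym by metis

lemma gdist_triangle:
  assumes "x \<in> verts G" "y \<in> verts G" "z \<in> verts G"
  shows "gdist G x z \<le> gdist G x y + gdist G y z"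
proof -
  have "(adj G ^^ (gdist G x y + gdist G y z)) x z"
    unfolding relpowp_add using gdist_walk assms by blast
  then show ?thesis by (rule gdist_le)
qed

lemma gdist_self: "gdist G x x = 0"
  using gdist_le[of 0 x x] by simp

lemma gdist_adj:
  assumes "adj G x y"
  shows "gdist G x y = 1"
proof -
  have V: "x \<in> verts G" "y \<in> verts G" "x \<noteq> y"
    using assms weight_diag by (auto simp: adj_def)
  then have "gdist G x y \<noteq> 0"
    using gdist_walk[of x y] by (intro notI) simp
  moreover have "gdist G x y \<le> 1"
    using assms gdist_le[of 1 x y] by (simp only: relpowp_1)
  ultimately show ?thesis by simp
qed

lemma gdist_Lip1:
  assumes "z \<in> verts G"
  shows "(\<lambda>x. real (gdist G z x)) \<in> Lip1 G"
  unfolding Lip1_def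
proof (clarsimp)
  fix x y assume V: "x \<in> verts G" "y \<in> verts G"
  have "gdist G z x \<le> gdist G z y + gdist G x y" "gdist G z y \<le> gdist G z x + gdist G x y"
    using gdist_triangle[of z y x] gdist_triangle[of z x y] V assms by (auto simp: gdist_sym)
  then show "\<bar>real (gdist G z x) - real (gdist G z y)\<bar> \<le> real (gdist G x y)"
    by linarith
qed

lemma Lip1_adj: "f \<in> Lip1 G \<Longrightarrow> adj G x y \<Longrightarrow> \<bar>f x - f y\<bar> \<le> 1"
  using gdist_adj by (force simp: Lip1_def adj_def)

lemma Lip1_uminus: "f \<in> Lip1 G \<Longrightarrow> (\<lambda>z. - f z) \<in> Lip1 G"
  by (simp add: Lip1_def abs_minus_commute)

lemma abs_laplacian_le:
  assumes "f \<in> Lip1 G" "x \<in> verts G"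
  shows "\<bar>laplacian G f x\<bar> \<le> Deg G x"
proof -
  have "\<bar>\<Sum>y | adj G x y. weight G x y * (f y - f x)\<bar> \<le> (\<Sum>y | adj G x y. weight G x y)"
  proof (rule order_trans[OF sum_abs sum_mono])
    fix y assume "y \<in> {y. adj G x y}"
    then have "adj G x y" by simp
    then have "\<bar>f y - f x\<bar> \<le> 1" "weight G x y \<ge> 0"
      using Lip1_adj[OF assms(1)] by (auto simp: adj_def abs_minus_commute)
    then show "\<bar>weight G x y * (f y - f x)\<bar> \<le> weight G x y"
      by (simp add: abs_mult mult_left_le)
  qed
  then show ?thesis
    using mass_pos[OF assms(2)] by (simp add: laplacian_def Deg_def divide_right_mono)
qed

section \<open>Walk measures, Wasserstein distance and curvature of edges\<close>

lemma has_sum_walk_measure: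
  assumes x: "x \<in> verts G"
  shows "((\<lambda>z. f z * walk_measure G e x z) has_sum (f x + e * laplacian G f x)) (verts G)"
proof -
  let ?N = "{y. adj G x y}"
  have fin: "finite ?N" using locally_finite[OF x] .
  have xN: "x \<notin> ?N" using weight_diag[OF x] by (simp add: adj_def)
  have "(\<Sum>z\<in>insert x ?N. f z * walk_measure G e x z)
      = f x * (1 - e * Deg G x) + (\<Sum>z\<in>?N. f z * walk_measure G e x z)"
    using fin xN by (simp add: walk_measure_def)
  also have "(\<Sum>z\<in>?N. f z * walk_measure G e x z)
      = (\<Sum>z\<in>?N. e / mass G x * (weight G x z * f z))"
    using xN by (intro sum.cong) (auto simp: walk_measure_def)
  also have "f x * (1 - e * Deg G x) + \<dots> = f x + e * laplacian G f x"
  proof -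
    have "laplacian G f x = (\<Sum>z\<in>?N. weight G x z * f z) / mass G x - f x * Deg G x"
      by (simp add: laplacian_def Deg_def right_diff_distrib sum_subtractf diff_divide_distrib
          sum_distrib_left mult.commute)
    then show ?thesis by (simp only: sum_distrib_left[symmetric]) (simp add: algebra_simps)
  qed
  finally have "((\<lambda>z. f z * walk_measure G e x z) has_sum (f x + e * laplacian G f x)) (insert x ?N)"
    using fin by (intro has_sum_finiteI) auto
  moreover have "f z * walk_measure G e x z = 0" if "z \<in> verts G - insert x ?N" for z
    using that x weight_nonneg[of x z] by (auto simp: walk_measure_def adj_def)
  moreover have "insert x ?N \<subseteq> verts G" using x by (auto simp: adj_def)
  ultimately show ?thesis
    using has_sum_cong_neutral[of "verts G" "insert x ?N"
        "\<lambda>z. f z * walk_measure G e x z" "\<lambda>z. f z * walk_measure G e x z"] by blast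
qed

lemma infsum_walk_measure_diff:
  assumes "x \<in> verts G" "y \<in> verts G"
  shows "(\<Sum>\<^sub>\<infinity>z\<in>verts G. f z * (walk_measure G e x z - walk_measure G e y z))
       = f x - f y + e * (laplacian G f x - laplacian G f y)"
proof -
  have "((\<lambda>z. - (f z * walk_measure G e y z)) has_sum - (f y + e * laplacian G f y)) (verts G)"
    using has_sum_walk_measure[OF assms(2)] by (simp only: has_sum_uminus minus_minus)
  from has_sum_add[OF has_sum_walk_measure[OF assms(1), of f e] this]
  show ?thesis by (intro infsumI) (simp add: algebra_simps)
qed

lemma wasserstein_walk_measure:
  assumes "x \<in> verts G" "y \<in> verts G"
  shows "wasserstein G (walk_measure G e x) (walk_measure G e y)
       = (SUP f \<in> {f \<in> Lip1 G. bounded (f ` verts G)}.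
            f x - f y + e * (laplacian G f x - laplacian G f y))"
  unfolding wasserstein_def infsum_walk_measure_diff[OF assms] ..

lemma bounded_Lip1_nonempty: "{f \<in> Lip1 G. bounded (f ` verts G)} \<noteq> {}"
proof -
  have "(\<lambda>_. 0) \<in> {f \<in> Lip1 G. bounded (f ` verts G)}"
    by (auto simp: Lip1_def intro!: boundedI[of _ 0])
  then show ?thesis by blast
qed

text \<open>The value at \<open>f\<close> depends only on \<open>f\<close> at \<open>x\<close>,
  \<open>y\<close> and their neighbours, so a truncation agreeing with \<open>f\<close> there is an
  admissible bounded competitor. This makes distance functions usable as potentials on infinite
  graphs.\<close>

lemma wasserstein_walk_measure_ge:
  assumes f: "f \<in> Lip1 G" and V: "x \<in> verts G" "y \<in> verts G"
  shows "f x - f y + e * (laplacian G f x - laplacian G f y)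
       \<le> wasserstein G (walk_measure G e x) (walk_measure G e y)"
proof -
  let ?F = "{f \<in> Lip1 G. bounded (f ` verts G)}"
  let ?B = "insert x (insert y ({z. adj G x z} \<union> {z. adj G y z}))"
  define N where "N = (\<Sum>z\<in>?B. \<bar>f z\<bar>)"
  \<comment> \<open>truncation of \<open>f\<close>, since distance functions may be unbounded\<close>
  define g where "g z = max (- N) (min N (f z))" for z
  have "finite ?B" using locally_finite V by simp
  then have "\<bar>f z\<bar> \<le> N" if "z \<in> ?B" for z
    unfolding N_def using that by (intro member_le_sum) auto
  then have eq: "g z = f z" if "z \<in> ?B" for z
    using that by (fastforce simp: g_def abs_le_iff)
  have "N \<ge> 0" unfolding N_def by (intro sum_nonneg) simp
  then have "\<bar>g z\<bar> \<le> N" for z by (auto simp: g_def)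
  then have bg: "bounded (g ` verts G)" by (intro boundedI[of _ N]) auto
  have "\<bar>g a - g b\<bar> \<le> \<bar>f a - f b\<bar>" for a b by (auto simp: g_def)
  then have "g \<in> Lip1 G" using f unfolding Lip1_def by (blast intro: order_trans)
  with bg have gF: "g \<in> ?F" by simp
  \<comment> \<open>A real supremum is only known to dominate a set that is bounded above; the
    common bound comes from \<open>Deg\<close>.\<close>
  have bdd: "bdd_above ((\<lambda>f. f x - f y + e * (laplacian G f x - laplacian G f y)) ` ?F)"
  proof (rule bdd_aboveI2)
    fix h assume "h \<in> ?F"
    then have h: "h \<in> Lip1 G" by simp
    have "\<bar>laplacian G h x - laplacian G h y\<bar> \<le> Deg G x + Deg G y"
      using abs_laplacian_le[OF h V(1)] abs_laplacian_le[OF h V(2)] by linarith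
    then have "\<bar>e * (laplacian G h x - laplacian G h y)\<bar> \<le> \<bar>e\<bar> * (Deg G x + Deg G y)"
      unfolding abs_mult by (rule mult_left_mono) simp
    moreover have "\<bar>h x - h y\<bar> \<le> real (gdist G x y)"
      using h V by (simp add: Lip1_def)
    ultimately show "h x - h y + e * (laplacian G h x - laplacian G h y)
        \<le> real (gdist G x y) + \<bar>e\<bar> * (Deg G x + Deg G y)"
      by linarith
  qed
  have "laplacian G f x = laplacian G g x" "laplacian G f y = laplacian G g y"
    by (rule laplacian_cong; simp add: eq)+
  then have "f x - f y + e * (laplacian G f x - laplacian G f y)
      = g x - g y + e * (laplacian G g x - laplacian G g y)"
    by (simp add: eq)
  also have "\<dots> \<le> wasserstein G (walk_measure G e x) (walk_measure G e y)"
    unfolding wasserstein_walk_measure[OF V] by (rule cSUP_upper[OF gF bdd])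
  finally show ?thesis .
qed

lemma wasserstein_walk_measure_leI:
  assumes "x \<in> verts G" "y \<in> verts G"
    and "\<And>f. f \<in> Lip1 G \<Longrightarrow> f x - f y + e * (laplacian G f x - laplacian G f y) \<le> c"
  shows "wasserstein G (walk_measure G e x) (walk_measure G e y) \<le> c"
  unfolding wasserstein_walk_measure[OF assms(1,2)]
  using assms(3) by (intro cSUP_least bounded_Lip1_nonempty) auto

text \<open>Since \<open>f x - f y\<close> equals the distance 1, the constant term cancels, and
  division by \<open>e\<close> leaves a bound free of \<open>e\<close>.\<close>

lemma curvature_eps_div_le:
  assumes "f \<in> Lip1 G" "adj G x y" "f x - f y = 1" "e > 0"
  shows "curvature_eps G e x y / e \<le> laplacian G f y - laplacian G f x"
proof -
  have "1 + e * (laplacian G f x - laplacian G f y)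
      \<le> wasserstein G (walk_measure G e x) (walk_measure G e y)"
    using wasserstein_walk_measure_ge[OF assms(1), of x y e] assms(2,3) by (simp add: adj_def)
  then have "curvature_eps G e x y \<le> (laplacian G f y - laplacian G f x) * e"
    using gdist_adj[OF assms(2)] by (simp add: curvature_eps_def algebra_simps)
  then show ?thesis using assms(4) by (simp add: divide_le_eq)
qed

text \<open>\<open>W\<close> is a supremum of affine functions of the step size whose value at 0 is
  at most 1, so it lies below the chord joining \<open>(0, 1)\<close> to
  \<open>(b, W b)\<close>.\<close>

lemma curvature_eps_div_antimono:
  assumes "adj G x y" "0 < a" "a \<le> b"
  shows "curvature_eps G b x y / b \<le> curvature_eps G a x y / a"
proof -
  define W where "W e = wasserstein G (walk_measure G e x) (walk_measure G e y)" for e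
  have V: "x \<in> verts G" "y \<in> verts G" using assms(1) by (auto simp: adj_def)
  \<comment> \<open>The right-hand side is the value of that chord at \<open>a\<close>.\<close>
  have "W a \<le> 1 - (1 - W b) / b * a"
    unfolding W_def[of a]
  proof (rule wasserstein_walk_measure_leI[OF V])
    fix f assume f: "f \<in> Lip1 G"
    define u where "u = f x - f y"
    define v where "v = laplacian G f x - laplacian G f y"
    have u: "u \<le> 1" using Lip1_adj[OF f assms(1)] by (simp add: u_def)
    have "u + b * v \<le> W b"
      using wasserstein_walk_measure_ge[OF f V] by (simp add: W_def u_def v_def)
    then have "(1 - W b) / b * a \<le> (1 - u - b * v) / b * a"
      using assms by (intro mult_right_mono divide_right_mono) auto
    also have "\<dots> = (1 - u) * (a / b) - a * v"
      using assms by (simp add: field_simps)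
    also have "\<dots> \<le> (1 - u) * 1 - a * v"
      using assms u by (intro diff_right_mono mult_left_mono) auto
    finally show "f x - f y + a * (laplacian G f x - laplacian G f y) \<le> 1 - (1 - W b) / b * a"
      by (simp add: u_def v_def)
  qed
  then show ?thesis
    using assms(2) gdist_adj[OF assms(1)]
    by (simp add: curvature_eps_def W_def[symmetric] pos_le_divide_eq)
qed

text \<open>\<open>curvature\<close> is a \<open>Lim\<close>, which carries information only once
  convergence is known; monotonicity and an upper bound supply it.\<close>

lemma curvature_eps_div_tendsto:
  assumes xy: "adj G x y"
  shows "((\<lambda>e. curvature_eps G e x y / e) \<longlongrightarrow> curvature G x y) (at_right 0)"
proof -
  let ?k = "\<lambda>e. curvature_eps G e x y / e"
  let ?f = "\<lambda>z. real (gdist G y z)"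
  have V: "x \<in> verts G" "y \<in> verts G" using xy by (auto simp: adj_def)
  \<comment> \<open>\<open>Lim_right_bound\<close> treats increasing functions bounded below, hence
    the negation.\<close>
  have "((\<lambda>e. - ?k e) \<longlongrightarrow> Inf ((\<lambda>e. - ?k e) ` ({0<..} \<inter> UNIV))) (at 0 within ({0<..} \<inter> UNIV))"
  proof (rule Lim_right_bound)
    show "- ?k a \<le> - ?k b" if "0 < a" "a \<le> b" for a b
      using curvature_eps_div_antimono[OF xy that] by simp
    \<comment> \<open>The distance from \<open>y\<close> rises by 1 from \<open>y\<close> to
      \<open>x\<close>, so it serves as the bounding potential.\<close>
    show "- (laplacian G ?f y - laplacian G ?f x) \<le> - ?k a" if "0 < a" for a
      using curvature_eps_div_le[OF gdist_Lip1[OF V(2)] xy _ that] gdist_adj[OF adj_sym[OF xy]]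
      by (simp add: gdist_self)
  qed
  then obtain l where "((\<lambda>e. - ?k e) \<longlongrightarrow> l) (at_right 0)" by auto
  then have "(?k \<longlongrightarrow> - l) (at_right 0)" using tendsto_minus by fastforce
  moreover from this have "curvature G x y = - l"
    unfolding curvature_def by (intro tendsto_Lim) auto
  ultimately show ?thesis by simp
qed

lemma curvature_le_laplacian_diff:
  assumes "f \<in> Lip1 G" "adj G x y" "f x - f y = 1"
  shows "curvature G x y \<le> laplacian G f y - laplacian G f x"
proof (rule tendsto_upperbound[OF curvature_eps_div_tendsto[OF assms(2)]])
  show "\<forall>\<^sub>F e in at_right 0. curvature_eps G e x y / e \<le> laplacian G f y - laplacian G f x"
    using eventually_at_right_less[of 0] curvature_eps_div_le[OF assms] by (auto elim: eventually_mono)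
qed simp

section \<open>Sphere curvatures, Laplacian comparison and averaging over spheres\<close>

lemma sphere_curvature_le_Max:
  assumes "x0 \<in> verts G" "y \<in> sphere_at G x0 r"
  shows "sphere_curvature G x0 r
    \<le> (MAX x \<in> {x \<in> sphere_at G x0 (r - 1). adj G x y}. curvature G x y)"
  unfolding sphere_curvature_def
  using assms finite_sphere_at[OF assms(1)] by (intro Min_le) auto

text \<open>One step towards the root: the minimum over the sphere is at most its entry at
  \<open>y\<close>, and the maximum there is attained because spheres are finite.\<close>

lemma sphere_curvature_le_obtain:
  assumes x0: "x0 \<in> verts G" and y: "y \<in> sphere_at G x0 (Suc r)"
  obtains x where "x \<in> sphere_at G x0 r" "adj G x y" "sphere_curvature G x0 (Suc r) \<le> curvature G x y"
proof -
  let ?P = "{x \<in> sphere_at G x0 r. adj G x y}"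
  have "?P \<noteq> {}" using sphere_at_SucE[OF x0 y] by blast
  then have "Max ((\<lambda>x. curvature G x y) ` ?P) \<in> (\<lambda>x. curvature G x y) ` ?P"
    using finite_sphere_at[OF x0] by (intro Max_in) auto
  then show thesis
    using that sphere_curvature_le_Max[OF x0 y] by auto
qed

text \<open>Induction outwards: \<open>y\<close> is compared with an inner neighbour as just
  obtained, which gains one sphere curvature per radius.\<close>

lemma laplacian_comparison:
  assumes x0: "x0 \<in> verts G" and "y \<in> sphere_at G x0 R"
  shows "laplacian G (\<lambda>z. real (gdist G x0 z)) y
       \<le> laplacian G (\<lambda>z. real (gdist G x0 z)) x0 - (\<Sum>r=1..R. sphere_curvature G x0 r)"
  using assms(2)
proof (induction R arbitrary: y)
  case 0
  then show ?case using sphere_at_0[OF x0] by simp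
next
  case (Suc R)
  let ?d = "\<lambda>z. real (gdist G x0 z)"
  obtain x where x: "x \<in> sphere_at G x0 R" "adj G x y"
    and k: "sphere_curvature G x0 (Suc R) \<le> curvature G x y"
    using sphere_curvature_le_obtain[OF x0 Suc.prems] by blast
  \<comment> \<open>As \<open>x\<close> is closer to the root, the potential that drops by 1 from
    \<open>x\<close> to \<open>y\<close> is the negated distance.\<close>
  have "curvature G x y \<le> laplacian G (\<lambda>z. - ?d z) y - laplacian G (\<lambda>z. - ?d z) x"
    using x Suc.prems
    by (intro curvature_le_laplacian_diff Lip1_uminus gdist_Lip1 x0) (auto simp: sphere_at_def)
  then have "laplacian G ?d y \<le> laplacian G ?d x - sphere_curvature G x0 (Suc R)"
    using k by (simp add: laplacian_uminus)
  then show ?case using Suc.IH[OF x(1)] by simp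
qed

text \<open>The mass of \<open>S\<^sub>R\<close> times the chain's Laplacian is the integral over \<open>S\<^sub>R\<close>:
  edges inside \<open>S\<^sub>R\<close> do not contribute.\<close>

lemma mass_laplacian_associated_chain:
  assumes x0: "x0 \<in> verts G" and R: "sphere_at G x0 R \<noteq> {}"
  shows "mass (associated_chain G x0) R * laplacian (associated_chain G x0) real R
       = (\<Sum>y\<in>sphere_at G x0 R. mass G y * laplacian G (\<lambda>z. real (gdist G x0 z)) y)"
proof -
  let ?C = "associated_chain G x0" and ?S = "sphere_at G x0"
  let ?d = "\<lambda>z. real (gdist G x0 z)"
  interpret C: weighted_graph ?C by (rule weighted_graph_associated_chain[OF x0])
  \<comment> \<open>Described without subtraction, so that \<open>R = 0\<close> yields only the
    radius 1.\<close>
  define U where "U = {n. n = R + 1 \<or> R = n + 1}"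
  have finU: "finite U" by (rule finite_subset[of _ "{..R + 1}"]) (auto simp: U_def)
  have RV: "R \<in> verts ?C" using R by (simp add: associated_chain_def)
  \<comment> \<open>The chain weight has the inner sphere as outer index; for \<open>n\<close> below
    \<open>R\<close>, symmetry and a swap move \<open>?S R\<close> outside.\<close>
  have wU: "weight ?C R n = (\<Sum>y\<in>?S R. \<Sum>z\<in>?S n. weight G y z)" if "n \<in> U" for n
  proof (cases "n = R + 1")
    case True
    then show ?thesis by (simp add: associated_chain_def)
  next
    case False
    with that have "R = n + 1" by (simp add: U_def)
    then have "weight ?C R n = (\<Sum>z\<in>?S n. \<Sum>y\<in>?S R. weight G z y)"
      by (simp add: associated_chain_def)
    also have "\<dots> = (\<Sum>z\<in>?S n. \<Sum>y\<in>?S R. weight G y z)"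
      by (intro sum.cong refl weight_sym) (auto simp: sphere_at_def)
    also have "\<dots> = (\<Sum>y\<in>?S R. \<Sum>z\<in>?S n. weight G y z)" by (rule sum.swap)
    finally show ?thesis .
  qed
  have sphere_sum: "(\<Sum>z | adj G y z. weight G y z * (?d z - ?d y))
      = (\<Sum>n\<in>U. \<Sum>z\<in>?S n. weight G y z * (real n - real R))" if y: "y \<in> ?S R" for y
  proof -
    have yV: "y \<in> verts G" "gdist G x0 y = R" using y by (auto simp: sphere_at_def)
    have "(\<Sum>n\<in>U. \<Sum>z\<in>?S n. weight G y z * (real n - real R))
        = (\<Sum>n\<in>U. \<Sum>z\<in>?S n. weight G y z * (?d z - ?d y))"
      using yV by (intro sum.cong refl) (auto simp: sphere_at_def)
    also have "\<dots> = (\<Sum>z\<in>(\<Union>n\<in>U. ?S n). weight G y z * (?d z - ?d y))"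
      using finU finite_sphere_at[OF x0]
      by (intro sum.UNION_disjoint[symmetric]) (auto simp: sphere_at_def)
    \<comment> \<open>Neither index set need contain the other, so the sum passes through their
      union: neighbours inside \<open>?S R\<close> have distance increment 0, non-neighbours have
      weight 0.\<close>
    also have "\<dots> = (\<Sum>z\<in>{z. adj G y z} \<union> (\<Union>n\<in>U. ?S n). weight G y z * (?d z - ?d y))"
    proof (rule sum.mono_neutral_left)
      show "finite ({z. adj G y z} \<union> (\<Union>n\<in>U. ?S n))"
        using locally_finite[OF yV(1)] finU finite_sphere_at[OF x0] by auto
      show "\<forall>z\<in>({z. adj G y z} \<union> (\<Union>n\<in>U. ?S n)) - (\<Union>n\<in>U. ?S n).
          weight G y z * (?d z - ?d y) = 0"
      proof
        fix z assume z: "z \<in> ({z. adj G y z} \<union> (\<Union>n\<in>U. ?S n)) - (\<Union>n\<in>U. ?S n)"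
        then have a: "adj G y z" and "gdist G x0 z \<notin> U" by (auto simp: sphere_at_def adj_def)
        moreover have "\<bar>?d y - ?d z\<bar> \<le> 1" using Lip1_adj[OF gdist_Lip1[OF x0] a] .
        ultimately have "gdist G x0 z = R" using yV(2) by (simp add: U_def) linarith
        then show "weight G y z * (?d z - ?d y) = 0" using yV(2) by simp
      qed
    qed auto
    also have "\<dots> = (\<Sum>z | adj G y z. weight G y z * (?d z - ?d y))"
    proof (rule sum.mono_neutral_right)
      show "finite ({z. adj G y z} \<union> (\<Union>n\<in>U. ?S n))"
        using locally_finite[OF yV(1)] finU finite_sphere_at[OF x0] by auto
      show "\<forall>z\<in>({z. adj G y z} \<union> (\<Union>n\<in>U. ?S n)) - {z. adj G y z}.
          weight G y z * (?d z - ?d y) = 0"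
        using weight_nonneg[OF yV(1)] yV(1) by (force simp: adj_def sphere_at_def)
    qed auto
    finally show ?thesis ..
  qed
  have "mass ?C R * laplacian ?C real R
      = (\<Sum>n | adj ?C R n. weight ?C R n * (real n - real R))"
    using C.mass_pos[OF RV] by (simp add: laplacian_def)
  also have "\<dots> = (\<Sum>n\<in>U. weight ?C R n * (real n - real R))"
  proof (rule sum.mono_neutral_left[OF finU])
    show "{n. adj ?C R n} \<subseteq> U"
      by (auto simp: adj_def associated_chain_def U_def split: if_splits)
    show "\<forall>n\<in>U - {n. adj ?C R n}. weight ?C R n * (real n - real R) = 0"
    proof
      fix n assume n: "n \<in> U - {n. adj ?C R n}"
      \<comment> \<open>The radius \<open>R + 1\<close> may fail to be a chain vertex when
        \<open>G\<close> is finite; its weight is then an empty sum.\<close>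
      have "weight ?C R n = 0"
      proof (cases "n \<in> verts ?C")
        case True
        then show ?thesis using n C.weight_nonneg[OF RV True] RV by (auto simp: adj_def)
      next
        case False
        then have "?S n = {}" by (simp add: associated_chain_def)
        then show ?thesis using n wU by simp
      qed
      then show "weight ?C R n * (real n - real R) = 0" by simp
    qed
  qed
  also have "\<dots> = (\<Sum>n\<in>U. \<Sum>y\<in>?S R. \<Sum>z\<in>?S n. weight G y z * (real n - real R))"
    by (intro sum.cong refl) (simp add: wU sum_distrib_right)
  also have "\<dots> = (\<Sum>y\<in>?S R. \<Sum>n\<in>U. \<Sum>z\<in>?S n. weight G y z * (real n - real R))"
    by (rule sum.swap)
  also have "\<dots> = (\<Sum>y\<in>?S R. mass G y * laplacian G ?d y)"
  proof (rule sum.cong[OF refl])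
    fix y assume y: "y \<in> ?S R"
    then have "mass G y > 0" by (intro mass_pos) (simp add: sphere_at_def)
    then show "(\<Sum>n\<in>U. \<Sum>z\<in>?S n. weight G y z * (real n - real R)) = mass G y * laplacian G ?d y"
      using sphere_sum[OF y] by (simp add: laplacian_def)
  qed
  finally show ?thesis .
qed

text \<open>The chain's Laplacian at \<open>R\<close> is the mass-weighted mean over the sphere, so
  a pointwise bound passes to it.\<close>

lemma laplacian_associated_chain_le:
  assumes x0: "x0 \<in> verts G" and R: "sphere_at G x0 R \<noteq> {}"
    and "\<And>y. y \<in> sphere_at G x0 R \<Longrightarrow> laplacian G (\<lambda>z. real (gdist G x0 z)) y \<le> c"
  shows "laplacian (associated_chain G x0) real R \<le> c"
proof -
  let ?C = "associated_chain G x0"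
  interpret C: weighted_graph ?C by (rule weighted_graph_associated_chain[OF x0])
  have m: "mass ?C R > 0" using R by (intro C.mass_pos) (simp add: associated_chain_def)
  have "mass ?C R * laplacian ?C real R \<le> (\<Sum>y\<in>sphere_at G x0 R. mass G y * c)"
    unfolding mass_laplacian_associated_chain[OF x0 R]
    using assms(3) mass_pos by (intro sum_mono mult_left_mono) (auto simp: sphere_at_def less_imp_le)
  also have "\<dots> = mass ?C R * c" by (simp add: associated_chain_def sum_distrib_right)
  finally show ?thesis using m by simp
qed

lemma laplacian_associated_chain_0:
  assumes x0: "x0 \<in> verts G"
  shows "laplacian (associated_chain G x0) real 0 = laplacian G (\<lambda>z. real (gdist G x0 z)) x0"
  using mass_laplacian_associated_chain[OF x0, of 0] sphere_at_0[OF x0] mass_pos[OF x0]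
  by (simp add: associated_chain_def)

end

text \<open>The dropped terms are nonnegative. On a chain at most one neighbour besides
  \<open>y\<close> has to be checked.\<close>

lemma (in weighted_graph) laplacian_ge_single_neighbour:
  assumes "adj G x y" "\<And>z. adj G x z \<Longrightarrow> z \<noteq> y \<Longrightarrow> h x \<le> h z"
  shows "weight G x y / mass G x * (h y - h x) \<le> laplacian G h x"
proof -
  have x: "x \<in> verts G" using assms(1) by (simp add: adj_def)
  have "weight G x y * (h y - h x)
      = (\<Sum>z | adj G x z. if z = y then weight G x z * (h z - h x) else 0)"
    using assms(1) locally_finite[OF x] by (simp add: sum.delta)
  also have "\<dots> \<le> (\<Sum>z | adj G x z. weight G x z * (h z - h x))"
    using assms(2) by (intro sum_mono) (auto simp: adj_def)
  finally show ?thesis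
    using mass_pos[OF x] by (simp add: laplacian_def divide_right_mono)
qed

section \<open>Curvature of birth-death chains\<close>

locale birth_death_chain = weighted_graph G for G :: "nat wgraph" +
  assumes adj_consecutive: "adj G k n \<Longrightarrow> n = k + 1 \<or> k = n + 1"
begin

text \<open>The difference \<open>h\<close> between the identity and a competitor is nondecreasing
  along edges. Hence the edges leaving the pair on either side favour the identity, and the loss on
  the edge itself, at most \<open>e * q * ?b\<close>, is absorbed by the gain \<open>?b\<close> for
  small \<open>e\<close>.\<close>

lemma curvature_chain_ge:
  assumes adj: "adj G (Suc s) s"
  shows "laplacian G real s - laplacian G real (Suc s) \<le> curvature G (Suc s) s"
proof (rule tendsto_lowerbound[OF curvature_eps_div_tendsto[OF adj]])
  let ?r = "Suc s"
  have V: "?r \<in> verts G" "s \<in> verts G" using adj by (auto simp: adj_def)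
  \<comment> \<open>The total jump rate across the edge in both directions; \<open>e * q < 1\<close>
    is the smallness condition.\<close>
  define q where "q = weight G ?r s / mass G ?r + weight G s ?r / mass G s"
  have "((\<lambda>e. 1 - e * q) \<longlongrightarrow> 1 - 0 * q) (at_right 0)"
    by (intro tendsto_intros)
  then have ev: "\<forall>\<^sub>F e in at_right 0. 0 < 1 - e * q"
    by (intro order_tendstoD(1)[where y = "1 - 0 * q"]) auto
  show "\<forall>\<^sub>F e in at_right 0.
      laplacian G real s - laplacian G real ?r \<le> curvature_eps G e ?r s / e"
    using ev eventually_at_right_less[of 0]
  proof eventually_elim
    case (elim e)
    have "wasserstein G (walk_measure G e ?r) (walk_measure G e s)
        \<le> 1 + e * (laplacian G real ?r - laplacian G real s)"
    proof (rule wasserstein_walk_measure_leI[OF V])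
      fix f assume f: "f \<in> Lip1 G"
      define h where "h k = real k - f k" for k
      have h_mono: "h k \<le> h (Suc k)" if "adj G k (Suc k)" for k
        using Lip1_adj[OF f that] by (simp add: h_def)
      let ?b = "h ?r - h s"
      have b: "?b \<ge> 0" using h_mono[OF adj_sym[OF adj]] by simp
      have "weight G ?r s / mass G ?r * (h s - h ?r) \<le> laplacian G h ?r"
        using adj_consecutive[of ?r] h_mono by (intro laplacian_ge_single_neighbour[OF adj]) fastforce
      \<comment> \<open>The remaining neighbour of \<open>s\<close> lies below it, where
        \<open>h\<close> is no larger, so the one-neighbour bound is applied to
        \<open>- h\<close>.\<close>
      moreover have "weight G s ?r / mass G s * (- h ?r - - h s) \<le> laplacian G (\<lambda>k. - h k) s"
      proof (rule laplacian_ge_single_neighbour[OF adj_sym[OF adj]])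
        fix k assume k: "adj G s k" "k \<noteq> ?r"
        then have "s = Suc k" using adj_consecutive by fastforce
        then show "- h s \<le> - h k" using h_mono adj_sym[OF k(1)] by simp
      qed
      ultimately have "- (q * ?b) \<le> laplacian G h ?r - laplacian G h s"
        by (simp add: laplacian_uminus q_def ring_distribs)
      then have "e * (- (q * ?b)) \<le> e * (laplacian G h ?r - laplacian G h s)"
        using elim by (intro mult_left_mono) auto
      moreover have "0 \<le> (1 - e * q) * ?b" using elim b by simp
      ultimately have "0 \<le> ?b + e * (laplacian G h ?r - laplacian G h s)"
        by (simp add: algebra_simps)
      moreover have "laplacian G h k = laplacian G real k - laplacian G f k" for k
        unfolding h_def by (rule laplacian_diff)
      ultimately show "f ?r - f s + e * (laplacian G f ?r - laplacian G f s)
          \<le> 1 + e * (laplacian G real ?r - laplacian G real s)"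
        by (simp add: h_def algebra_simps)
    qed
    then have "(laplacian G real s - laplacian G real ?r) * e \<le> curvature_eps G e ?r s"
      using gdist_adj[OF adj] by (simp add: curvature_eps_def algebra_simps)
    then show ?case using elim by (simp add: pos_le_divide_eq)
  qed
qed simp

lemma sum_curvature_chain_ge:
  assumes "\<And>k. k < R \<Longrightarrow> adj G (Suc k) k"
  shows "laplacian G real 0 - laplacian G real R \<le> (\<Sum>r=1..R. curvature G r (r - 1))"
  using assms
proof (induction R)
  case (Suc R)
  have "laplacian G real 0 - laplacian G real R \<le> (\<Sum>r=1..R. curvature G r (r - 1))"
    using Suc by simp
  moreover have "laplacian G real R - laplacian G real (Suc R) \<le> curvature G (Suc R) R"
    using Suc.prems by (intro curvature_chain_ge) simp
  ultimately show ?case by simp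
qed simp

end

lemma (in weighted_graph) birth_death_chain_associated_chain:
  assumes "x0 \<in> verts G"
  shows "birth_death_chain (associated_chain G x0)"
proof -
  interpret C: weighted_graph "associated_chain G x0"
    by (rule weighted_graph_associated_chain[OF assms])
  show ?thesis
    by unfold_locales (auto simp: adj_def associated_chain_def split: if_splits)
qed

text \<open>Discrete intermediate value argument: a walk from 0 moves by 1 per step, so it gets
  beyond \<open>k\<close> only by crossing the edge from \<open>k\<close> to
  \<open>Suc k\<close>.\<close>

lemma (in birth_death_chain) adj_Suc:
  assumes "0 \<in> verts G" "Suc k \<in> verts G"
  shows "adj G (Suc k) k"
proof -
  have "(adj G ^^ i) 0 n \<Longrightarrow> n > k \<Longrightarrow> adj G k (Suc k)" for i n
  proof (induction i arbitrary: n)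
    case (Suc i)
    then obtain m where m: "(adj G ^^ i) 0 m" "adj G m n" by auto
    show ?case
    proof (cases "m > k")
      case False
      then have "n = Suc m \<and> m = k" using adj_consecutive[OF m(2)] Suc.prems by auto
      then show ?thesis using m by simp
    qed (use Suc.IH m in blast)
  qed simp
  then have "adj G k (Suc k)" using connected[OF assms] by blast
  then show ?thesis by (rule adj_sym)
qed

theorem corollary4p8:
  fixes G :: "'a wgraph" and x0 :: 'a and R :: nat
  assumes "weighted_graph G"
    and "x0 \<in> verts G"
    and "R \<ge> 1"
    and "sphere_at G x0 R \<noteq> {}"
  shows "(\<Sum>r=1..R. curvature (associated_chain G x0) r (r - 1))
           \<ge> (\<Sum>r=1..R. sphere_curvature G x0 r)"
proof -
  interpret weighted_graph G by fact
  let ?C = "associated_chain G x0" and ?d = "\<lambda>z. real (gdist G x0 z)"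
  interpret C: birth_death_chain ?C by (rule birth_death_chain_associated_chain[OF assms(2)])
  \<comment> \<open>For finite \<open>G\<close> the chain lives on an initial segment of the
    naturals; the nonempty sphere of radius \<open>R\<close> places all radii of the sum inside
    it.\<close>
  have V: "k \<in> verts ?C" if "k \<le> R" for k
    using sphere_at_nonempty_mono[OF assms(2,4) that] by (simp add: associated_chain_def)
  have "laplacian ?C real R \<le> laplacian G ?d x0 - (\<Sum>r=1..R. sphere_curvature G x0 r)"
    using laplacian_comparison[OF assms(2)] by (rule laplacian_associated_chain_le[OF assms(2,4)])
  also have "laplacian G ?d x0 = laplacian ?C real 0"
    using laplacian_associated_chain_0[OF assms(2)] by simp
  finally have "(\<Sum>r=1..R. sphere_curvature G x0 r) \<le> laplacian ?C real 0 - laplacian ?C real R"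
    by simp
  also have "\<dots> \<le> (\<Sum>r=1..R. curvature ?C r (r - 1))"
    using V by (intro C.sum_curvature_chain_ge C.adj_Suc) auto
  finally show ?thesis .
qed

end
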